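(* Let $A=\mathbb{Z}[y_1,\ldots,y_n]$, $Y_i=y_i-y_1$ for $1\le i\le n$, and $\mathtt{p}=\prod_{j=1}^n(X-Y_j)\in A[X]$. Let $D=(D_0,D_1,\ldots)$ be the canonical sequence of endomorphisms of $\bigwedge M(\mathtt{p})$ and $(\mu^1,\ldots,\mu^n)$ the $A$-basis of $M(\mathtt{p})$ defined in the context. Then for every $1\le k\le n$, every $I=(i_1,\ldots,i_k)$ with $1\le i_1<\cdots<i_k\le n$, and every $l\ge 0$, the following ($T$-equivariant Pieri's) formula holds: $$D_l(\mu^{i_1}\wedge\cdots\wedge\mu^{i_k})=\sum_{u=0}^{l}\ \sum_{(m_1,\ldots,m_k)\in \mathcal{P}(I,l-u)} h_{u}(Y_{i_1},\ldots,Y_{i_1+m_1},\ldots, Y_{i_k},\ldots, Y_{i_k+m_k})\; \mu^{i_1+m_1}\wedge\cdots\wedge\mu^{i_k+m_k}.$$ Here the arguments of $h_u$ are all the $Y_s$ with $i_j\le s\le i_j+m_j$, for $j=1,\ldots,k$.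
   Context: Let $X$ be an indeterminate over $A$, $M=XA[X]$, $M(\mathtt{p})=M/\mathtt{p}M$, and $\epsilon^i=X^i+\mathtt{p}M$ for $i\ge 1$; $M(\mathtt{p})$ is a free $A$-module with basis $\epsilon^1,\ldots,\epsilon^n$. There is a unique sequence $D=(D_0,D_1,\ldots)$ of $A$-endomorphisms of the exterior algebra $\bigwedge M(\mathtt{p})$ such that $D_h(\alpha\wedge\beta)=\sum_{h_1+h_2=h,\ h_1,h_2\ge0}D_{h_1}\alpha\wedge D_{h_2}\beta$ for all $h\ge0$ and all $\alpha,\beta\in\bigwedge M(\mathtt{p})$, and $D_h\epsilon^i=\epsilon^{i+h}$ for all $h\ge0$, $i\ge1$. Set $\mathtt{p}_0=1$, $\mathtt{p}_i=\prod_{1\le j\le i}(X-Y_j)$ for $1\le i\le n$ (so $\mathtt{p}_n=\mathtt{p}$), and $\mu^i=X\cdot\mathtt{p}_{i-1}+\mathtt{p}M\in M(\mathtt{p})$ for $1\le i\le n$; $(\mu^1,\ldots,\mu^n)$ is an $A$-basis of $M(\mathtt{p})$. Convention: $\mu^m=0$ for $m>n$, so terms containing such a $\mu^m$ are to be omitted (the symbols $Y_s$ with $s>n$ occur only in such terms). $h_u$ is the complete homogeneous symmetric polynomial of degree $u$ in its arguments, with $h_0=1$. For $I=(i_1,\ldots,i_k)$ with $1\le i_1<\cdots<i_k$ and $h\ge0$, $\mathcal{P}(I,h)$ is the set of $(h_1,\ldots,h_k)$ of nonnegative integers with $h_1+\cdots+h_k=h$ and $i_j+h_j<i_{j+1}$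 for $1\le j\le k-1$ (no upper bound on $h_k$ is imposed beyond the sum condition). *)

theory Defs
  imports
    "HOL-Library.Poly_Mapping"
    "HOL-Library.Cardinality"
    "HOL-Computational_Algebra.Polynomial"
begin

text \<open>Otherwise \<open>\<Rightarrow>\<^sub>0\<close> would be unfolded when lifting operations to the quotient types below.\<close>

lifting_forget poly_mapping.lifting

section \<open>The base ring\<close>

text \<open>
  The type variable \<open>'n\<close> only serves to provide the number \<open>n = CARD('n)\<close>, which ranges over
  all positive integers; the variables \<open>y\<^sub>1, \<dots>, y\<^sub>n\<close> are indexed by \<open>{1..n}\<close>.
\<close>

typedef (overloaded) ('n::finite) idx = "{1..CARD('n)}"
  by (rule exI[of _ 1]) (simp add: Suc_leI)

text \<open>\<open>A = \<int>[y\<^sub>1, \<dots>, y\<^sub>n]\<close>: finitely supported integer functions on the monomials, which in turn are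
  finitely supported exponent functions.\<close>

type_synonym 'n base = "('n idx \<Rightarrow>\<^sub>0 nat) \<Rightarrow>\<^sub>0 int"

text \<open>Only the values at \<open>1 \<le> i \<le> n\<close> are meaningful in \<open>yvar\<close> and \<open>Y\<close>.\<close>

definition yvar :: "nat \<Rightarrow> ('n::finite) base" where
  "yvar i = Poly_Mapping.single (Poly_Mapping.single (Abs_idx i) 1) 1"

definition Y :: "nat \<Rightarrow> ('n::finite) base" where
  "Y i = yvar i - yvar 1"

section \<open>The module \<open>M(p)\<close>\<close>

text \<open>\<open>M = X A[X]\<close>, the products \<open>p\<^sub>i\<close>, and \<open>p = p\<^sub>n\<close>; \<open>M(p) = M / p M\<close> is a quotient of the subset \<open>M\<close> of
  \<open>A[X]\<close>, hence a partial quotient.\<close>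

definition XM :: "('n::finite) base poly set" where
  "XM = range (\<lambda>f. [:0, 1:] * f)"

definition pp :: "nat \<Rightarrow> ('n::finite) base poly" where
  "pp i = (\<Prod>j\<in>{1..i}. [:- Y j, 1:])"

definition pfull :: "('n::finite) base poly" where
  "pfull = pp CARD('n)"

definition Mp_rel :: "('n::finite) base poly \<Rightarrow> 'n base poly \<Rightarrow> bool" where
  "Mp_rel f g \<longleftrightarrow> f \<in> XM \<and> g \<in> XM \<and> f - g \<in> (\<lambda>m. pfull * m) ` XM"

lemma XM_X: "[:0, 1:] * f \<in> XM"
  unfolding XM_def by (rule rangeI)

lemma XM_0: "0 \<in> XM"
  unfolding XM_def by (rule range_eqI[of _ _ 0]) simp

lemma XM_add: "f \<in> XM \<Longrightarrow> g \<in> XM \<Longrightarrow> f + g \<in> XM"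
  unfolding XM_def by (auto simp only: distrib_left[symmetric])

lemma XM_mult: "f \<in> XM \<Longrightarrow> g * f \<in> XM"
  unfolding XM_def by (auto simp only: mult.left_commute[of g])

lemma XM_uminus: "f \<in> XM \<Longrightarrow> - f \<in> XM"
  using XM_mult[of f "-1"] by simp

lemma XM_diff: "f \<in> XM \<Longrightarrow> g \<in> XM \<Longrightarrow> f - g \<in> XM"
  using XM_add[OF _ XM_uminus, of f g] by simp

lemma XM_smult: "f \<in> XM \<Longrightarrow> smult c f \<in> XM"
  using XM_mult[of f "[:c:]"] by simp

lemma pXM_0: "0 \<in> (\<lambda>m. pfull * m) ` XM"
  using XM_0 by force

lemma pXM_add:
  "f \<in> (\<lambda>m. pfull * m) ` XM \<Longrightarrow> g \<in> (\<lambda>m. pfull * m) ` XM \<Longrightarrow> f + g \<in> (\<lambda>m. pfull * m) ` XM"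
  by (auto simp only: distrib_left[symmetric] intro!: imageI XM_add)

lemma pXM_mult: "f \<in> (\<lambda>m. pfull * m) ` XM \<Longrightarrow> g * f \<in> (\<lambda>m. pfull * m) ` XM"
  by (auto simp only: mult.left_commute[of g] intro!: imageI XM_mult)

lemma pXM_uminus: "f \<in> (\<lambda>m. pfull * m) ` XM \<Longrightarrow> - f \<in> (\<lambda>m. pfull * m) ` XM"
  using pXM_mult[of f "-1"] by simp

lemma Mp_rel_refl: "Mp_rel f f \<longleftrightarrow> f \<in> XM"
  by (simp only: Mp_rel_def diff_self pXM_0 simp_thms)

lemma Mp_relI: "f \<in> XM \<Longrightarrow> f = g \<Longrightarrow> Mp_rel f g"
  by (simp only: Mp_rel_refl)

lemma part_equivp_Mp_rel: "part_equivp (Mp_rel :: ('n::finite) base poly \<Rightarrow> _)"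
proof (rule part_equivpI)
  let ?R = "Mp_rel :: 'n base poly \<Rightarrow> _"
  show "\<exists>f. ?R f f"
    by (rule exI[of _ 0]) (simp add: Mp_rel_def XM_0 pXM_0)
  show "symp ?R"
    unfolding symp_def Mp_rel_def by (metis pXM_uminus minus_diff_eq)
  show "transp ?R"
  proof (rule transpI)
    fix f g h :: "'n base poly"
    assume "Mp_rel f g" "Mp_rel g h"
    then show "Mp_rel f h"
      using pXM_add[of "f - g" "g - h"] by (simp add: Mp_rel_def)
  qed
qed

quotient_type (overloaded) 'n Mp = "('n::finite) base poly" / partial: Mp_rel
  by (rule part_equivp_Mp_rel)

instantiation Mp :: (finite) ab_group_add
begin

lift_definition zero_Mp :: "'a Mp" is 0
  by (simp only: Mp_rel_refl XM_0)

lift_definition plus_Mp :: "'a Mp \<Rightarrow> 'a Mp \<Rightarrow> 'a Mp" is "(+)"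
  by (simp only: Mp_rel_def XM_add pXM_add add_diff_add simp_thms)

lift_definition uminus_Mp :: "'a Mp \<Rightarrow> 'a Mp" is uminus
  by (simp only: Mp_rel_def XM_uminus pXM_uminus minus_diff_minus simp_thms)

lift_definition minus_Mp :: "'a Mp \<Rightarrow> 'a Mp \<Rightarrow> 'a Mp" is "(-)"
proof -
  fix f f' g g' :: "'a base poly"
  assume *: "Mp_rel f f'" "Mp_rel g g'"
  have "f - g - (f' - g') = (f - f') + - (g - g')"
    by (simp only: diff_conv_add_uminus minus_add_distrib minus_minus ac_simps)
  with * show "Mp_rel (f - g) (f' - g')"
    by (simp only: Mp_rel_def XM_diff pXM_add pXM_uminus simp_thms)
qed

instance
proof
  fix a b c :: "'a Mp"
  show "a + b + c = a + (b + c)"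
    by (transfer, rule Mp_relI) (simp_all only: Mp_rel_refl XM_add add.assoc)
  show "a + b = b + a"
    by (transfer, rule Mp_relI) (simp_all only: Mp_rel_refl XM_add add.commute)
  show "0 + a = a"
    by (transfer, rule Mp_relI) (simp_all only: Mp_rel_refl XM_0 XM_add add_0)
  show "- a + a = 0"
    by (transfer, rule Mp_relI) (simp_all only: Mp_rel_refl XM_0 left_minus)
  show "a - b = a + - b"
    by (transfer, rule Mp_relI) (simp_all only: Mp_rel_refl XM_uminus XM_add diff_conv_add_uminus)
qed

end

lift_definition scaleMp :: "('n::finite) base \<Rightarrow> 'n Mp \<Rightarrow> 'n Mp" is smult
proof -
  fix c :: "'n base" and f g :: "'n base poly"
  assume "Mp_rel f g"
  then show "Mp_rel (smult c f) (smult c g)"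
    using pXM_mult[of "f - g" "[:c:]"] by (simp add: Mp_rel_def XM_smult smult_diff_right)
qed

lemma module_scaleMp: "module scaleMp"
  by standard
    (transfer, rule Mp_relI;
      simp only: Mp_rel_refl XM_smult XM_add smult_add_right smult_add_left smult_smult smult_1_left)+

text \<open>The class of \<open>X\<^sup>i\<close>, for \<open>i \<ge> 1\<close>; the value at \<open>0\<close> is a dummy.\<close>

lift_definition eps :: "nat \<Rightarrow> ('n::finite) Mp" is "\<lambda>i. if i = 0 then 0 else [:0, 1:] ^ i"
proof -
  fix i :: nat
  have "(if i = 0 then 0 else [:0, 1 :: 'n base:] ^ i) \<in> XM"
    using XM_0 XM_X by (cases i) (simp_all only: power_Suc if_True if_False nat.distinct refl)
  then show "Mp_rel (if i = 0 then 0 else [:0, 1 :: 'n base:] ^ i)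
      (if i = 0 then 0 else [:0, 1:] ^ i)"
    by (simp only: Mp_rel_refl)
qed

text \<open>The class of \<open>X \<sqdot> p\<^sub>i\<^sub>-\<^sub>1\<close> for \<open>1 \<le> i \<le> n\<close>, and \<open>0\<close> for \<open>i > n\<close>; the value at index \<open>0\<close> is a dummy.\<close>

lift_definition mu :: "nat \<Rightarrow> ('n::finite) Mp" is
  "\<lambda>i. if i \<in> {1..CARD('n)} then [:0, 1:] * pp (i - 1) else 0"
proof -
  fix i :: nat
  have "(if i \<in> {1..CARD('n)} then [:0, 1:] * pp (i - 1) else 0) \<in> (XM :: 'n base poly set)"
    by (simp only: XM_0 XM_X simp_thms split: if_split)
  then show "Mp_rel (if i \<in> {1..CARD('n)} then [:0, 1:] * pp (i - 1) else (0 :: 'n base poly))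
      (if i \<in> {1..CARD('n)} then [:0, 1:] * pp (i - 1) else 0)"
    by (simp only: Mp_rel_refl)
qed

section \<open>The exterior algebra\<close>

text \<open>
  The exterior algebra of a module is constructed by generators and relations: the free associative
  algebra on the set underlying the module, modulo the two-sided ideal generated by the relations
  saying that the module embeds linearly (these alone would give the tensor algebra) and that
  \<open>m \<and> m = 0\<close>.  The free algebra consists of the finitely supported functions on words, with the
  convolution product induced by concatenation of words; scalars commute with words there.
\<close>

datatype 'm word = Word (letters: "'m list")

instantiation word :: (type) monoid_add
begin
definition zero_word :: "'a word" where "zero_word = Word []"
definition plus_word :: "'a word \<Rightarrow> 'a word \<Rightarrow> 'a word" where
  "plus_word v w = Word (letters v @ letters w)"
instance by standard (simp_all add: zero_word_def plus_word_def)
end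

inductive_set ext_ideal ::
  "('a::comm_ring_1 \<Rightarrow> 'm::ab_group_add \<Rightarrow> 'm) \<Rightarrow> ('m word \<Rightarrow>\<^sub>0 'a) set"
  for scale :: "'a \<Rightarrow> 'm \<Rightarrow> 'm"
where
  rel_add: "Poly_Mapping.single (Word [m + m']) 1
      - (Poly_Mapping.single (Word [m]) 1 + Poly_Mapping.single (Word [m']) 1) \<in> ext_ideal scale"
| rel_scale: "Poly_Mapping.single (Word [scale c m]) 1
      - Poly_Mapping.single (Word [m]) c \<in> ext_ideal scale"
| rel_square: "Poly_Mapping.single (Word [m]) 1 * Poly_Mapping.single (Word [m]) 1
      \<in> ext_ideal scale"
| ideal_add: "x \<in> ext_ideal scale \<Longrightarrow> y \<in> ext_ideal scale \<Longrightarrow> x + y \<in> ext_ideal scale"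
| ideal_left: "x \<in> ext_ideal scale \<Longrightarrow> a * x \<in> ext_ideal scale"
| ideal_right: "x \<in> ext_ideal scale \<Longrightarrow> x * a \<in> ext_ideal scale"

lemma ext_ideal_0: "0 \<in> ext_ideal scale"
  using ideal_left[OF rel_square, of 0] by simp

lemma ext_ideal_uminus: "x \<in> ext_ideal scale \<Longrightarrow> - x \<in> ext_ideal scale"
  using ideal_left[of x scale "- 1"] by simp

definition Ext_rel :: "(('n::finite) Mp word \<Rightarrow>\<^sub>0 'n base) \<Rightarrow> ('n Mp word \<Rightarrow>\<^sub>0 'n base) \<Rightarrow> bool" where
  "Ext_rel x y \<longleftrightarrow> x - y \<in> ext_ideal scaleMp"

lemma Ext_relI: "x = y \<Longrightarrow> Ext_rel x y"
  by (simp only: Ext_rel_def diff_self ext_ideal_0)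

lemma equivp_Ext_rel: "equivp (Ext_rel :: (('n::finite) Mp word \<Rightarrow>\<^sub>0 'n base) \<Rightarrow> _)"
proof (rule equivpI)
  let ?R = "Ext_rel :: ('n Mp word \<Rightarrow>\<^sub>0 'n base) \<Rightarrow> _"
  show "reflp ?R"
    by (simp add: reflp_def Ext_rel_def ext_ideal_0)
  show "symp ?R"
    unfolding symp_def Ext_rel_def by (metis ext_ideal_uminus minus_diff_eq)
  show "transp ?R"
  proof (rule transpI)
    fix x y z :: "'n Mp word \<Rightarrow>\<^sub>0 'n base"
    assume "Ext_rel x y" "Ext_rel y z"
    then show "Ext_rel x z"
      using ideal_add[of "x - y" scaleMp "y - z"] by (simp add: Ext_rel_def)
  qed
qed

quotient_type (overloaded) 'n Ext = "('n::finite) Mp word \<Rightarrow>\<^sub>0 'n base" / Ext_rel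
  by (rule equivp_Ext_rel)

text \<open>The ring multiplication of \<open>'n Ext\<close> is the exterior product.\<close>

instantiation Ext :: (finite) ring
begin

lift_definition zero_Ext :: "'a Ext" is 0 .

lift_definition plus_Ext :: "'a Ext \<Rightarrow> 'a Ext \<Rightarrow> 'a Ext" is "(+)"
  by (simp only: Ext_rel_def ideal_add add_diff_add)

lift_definition uminus_Ext :: "'a Ext \<Rightarrow> 'a Ext" is uminus
  by (simp only: Ext_rel_def ext_ideal_uminus minus_diff_minus)

lift_definition minus_Ext :: "'a Ext \<Rightarrow> 'a Ext \<Rightarrow> 'a Ext" is "(-)"
proof -
  fix x x' y y' :: "'a Mp word \<Rightarrow>\<^sub>0 'a base"
  assume *: "Ext_rel x x'" "Ext_rel y y'"
  have "x - y - (x' - y') = (x - x') + - (y - y')"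
    by (simp only: diff_conv_add_uminus minus_add_distrib minus_minus ac_simps)
  with * show "Ext_rel (x - y) (x' - y')"
    by (simp only: Ext_rel_def ideal_add ext_ideal_uminus)
qed

lift_definition times_Ext :: "'a Ext \<Rightarrow> 'a Ext \<Rightarrow> 'a Ext" is "(*)"
proof -
  fix x x' y y' :: "'a Mp word \<Rightarrow>\<^sub>0 'a base"
  assume *: "Ext_rel x x'" "Ext_rel y y'"
  have "x * y - x' * y' = (x - x') * y + x' * (y - y')"
    by (simp add: algebra_simps)
  with * show "Ext_rel (x * y) (x' * y')"
    by (simp add: Ext_rel_def ideal_add ideal_left ideal_right)
qed

instance
proof
  fix a b c :: "'a Ext"
  show "a + b + c = a + (b + c)"
    by (transfer, rule Ext_relI) (rule add.assoc)
  show "a + b = b + a"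
    by (transfer, rule Ext_relI) (rule add.commute)
  show "0 + a = a"
    by (transfer, rule Ext_relI) (rule add_0)
  show "- a + a = 0"
    by (transfer, rule Ext_relI) (rule left_minus)
  show "a - b = a + - b"
    by (transfer, rule Ext_relI) (rule diff_conv_add_uminus)
  show "a * b * c = a * (b * c)"
    by (transfer, rule Ext_relI) (rule mult.assoc)
  show "(a + b) * c = a * c + b * c"
    by (transfer, rule Ext_relI) (rule distrib_right)
  show "a * (b + c) = a * b + a * c"
    by (transfer, rule Ext_relI) (rule distrib_left)
qed

end

instantiation Ext :: (finite) monoid_mult
begin

lift_definition one_Ext :: "'a Ext" is 1 .

instance
proof
  fix a :: "'a Ext"
  show "1 * a = a"
    by (transfer, rule Ext_relI) (rule mult_1_left)
  show "a * 1 = a"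
    by (transfer, rule Ext_relI) (rule mult_1_right)
qed

end

lift_definition scaleE :: "('n::finite) base \<Rightarrow> 'n Ext \<Rightarrow> 'n Ext" is
  "\<lambda>c x. Poly_Mapping.single 0 c * x"
  by (simp only: Ext_rel_def ideal_left right_diff_distrib[symmetric])

lemma module_scaleE: "module scaleE"
  by standard
    (transfer, rule Ext_relI,
      simp add: distrib_left distrib_right single_add mult_single flip: mult.assoc)+

text \<open>The canonical map \<open>M(p) \<rightarrow> \<And>M(p)\<close>.\<close>

definition emb :: "('n::finite) Mp \<Rightarrow> 'n Ext" where
  "emb m = abs_Ext (Poly_Mapping.single (Word [m]) 1)"

lemma emb_add: "emb (m + m') = emb m + emb m'"
  by (simp add: emb_def plus_Ext.abs_eq Ext.abs_eq_iff Ext_rel_def rel_add)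

lemma emb_scale: "emb (scaleMp c m) = scaleE c (emb m)"
  using rel_scale[of scaleMp c m]
  by (simp add: emb_def scaleE.abs_eq Ext.abs_eq_iff Ext_rel_def mult_single)

lemma emb_square: "emb m * emb m = 0"
  using rel_square[of m scaleMp]
  by (simp add: emb_def times_Ext.abs_eq zero_Ext_def Ext.abs_eq_iff Ext_rel_def)

lemma scaleE_mult_left: "scaleE c x * y = scaleE c (x * y)"
  by (transfer, rule Ext_relI) (rule mult.assoc)

definition wedge :: "('n::finite) Mp list \<Rightarrow> 'n Ext" where
  "wedge ms = prod_list (map emb ms)"

text \<open>
  The defining properties of the canonical sequence \<open>D = (D\<^sub>0, D\<^sub>1, \<dots>)\<close>, which determine it uniquely.
  The endomorphisms are module endomorphisms, not algebra endomorphisms.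
\<close>

definition canonical_seq :: "(nat \<Rightarrow> ('n::finite) Ext \<Rightarrow> 'n Ext) \<Rightarrow> bool" where
  "canonical_seq D \<longleftrightarrow>
     (\<forall>h. module_hom scaleE scaleE (D h)) \<and>
     (\<forall>h \<alpha> \<beta>. D h (\<alpha> * \<beta>) = (\<Sum>(h1, h2) \<in> {(h1, h2). h1 + h2 = h}. D h1 \<alpha> * D h2 \<beta>)) \<and>
     (\<forall>h. \<forall>i\<ge>1. D h (emb (eps i)) = emb (eps (i + h)))"

section \<open>Combinatorial data\<close>

text \<open>Complete homogeneous symmetric polynomial of degree \<open>u\<close>, evaluated at a list of arguments:
  the sum over all exponent vectors of total degree \<open>u\<close>.\<close>

definition chsym :: "nat \<Rightarrow> 'a::comm_ring_1 list \<Rightarrow> 'a" where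
  "chsym u xs = (\<Sum>e \<in> {e. length e = length xs \<and> sum_list e = u}. \<Prod>j<length xs. (xs ! j) ^ (e ! j))"

text \<open>Tuples are lists, so the indices are shifted by one: entry \<open>i\<^sub>j\<close> is \<open>I ! (j - 1)\<close>.\<close>

definition pieri_set :: "nat list \<Rightarrow> nat \<Rightarrow> nat list set" where
  "pieri_set I h = {m. length m = length I \<and> sum_list m = h \<and>
     (\<forall>j. Suc j < length I \<longrightarrow> I ! j + m ! j < I ! Suc j)}"

text \<open>The list of all \<open>Y\<^sub>s\<close> with \<open>i\<^sub>j \<le> s \<le> i\<^sub>j + m\<^sub>j\<close>, for \<open>j = 1, \<dots>, k\<close>.\<close>

definition Yargs :: "nat list \<Rightarrow> nat list \<Rightarrow> ('n::finite) base list" where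
  "Yargs I m = concat (map (\<lambda>(i, d). map Y [i..<Suc (i + d)]) (zip I m))"

end

theory Submission
  imports Defs "HOL-Computational_Algebra.Formal_Power_Series"
begin

text \<open>
  Put \<open>D(x) = \<Sum>\<^sub>l D\<^sub>l(x) t\<^sup>l\<close>, a power series over the exterior algebra.  The Leibniz rule says that \<open>D\<close>
  turns exterior products into products of power series, so everything is determined by the series
  \<open>D(\<mu>\<^sup>i)\<close>.  On \<open>M(p)\<close> itself \<open>D\<^sub>l\<close> is multiplication by \<open>X\<^sup>l\<close>
  (lemma \<open>canonical_seq_cls\<close>), and consecutive \<open>\<mu>\<^sup>i\<close> differ by the factor \<open>X - Y\<^sub>i\<close>.  This yields
  \<open>(1 - Y\<^sub>i t) D(\<mu>\<^sup>i) = \<mu>\<^sup>i + t D(\<mu>\<^sup>i\<^sup>+\<^sup>1)\<close>, and iterating it (lemma \<open>Dfps_mu_split\<close>),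
  \<open>D(\<mu>\<^sup>i) = \<Sum>\<^sub>d\<^sub><\<^sub>j\<^sub>-\<^sub>i t\<^sup>d \<Prod>\<^sub>s (1 - Y\<^sub>s t)\<^sup>-\<^sup>1 \<mu>\<^sup>i\<^sup>+\<^sup>d + C D(\<mu>\<^sup>j)\<close> for every \<open>j \<ge> i\<close>, where \<open>s\<close> runs from
  \<open>i\<close> to \<open>i + d\<close> and \<open>C\<close> has coefficients in \<open>A\<close>.

  In the product \<open>D(\<mu>\<^sup>i\<^sup>1) \<dots> D(\<mu>\<^sup>i\<^sup>k)\<close> take for \<open>j\<close> the next index \<open>i\<^sub>2\<close>: the remainder \<open>C D(\<mu>\<^sup>j)\<close>
  of the first factor meets the second factor \<open>D(\<mu>\<^sup>j)\<close> and dies, because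
  \<open>D(\<mu>\<^sup>j) D(\<mu>\<^sup>j) = D(\<mu>\<^sup>j \<and> \<mu>\<^sup>j) = 0\<close>.  So every factor may be truncated just below the next index,
  which is the condition defining \<open>\<P>(I, h)\<close>; no cancellation of signs is involved.  The last
  factor is truncated at \<open>j = n + 1\<close>, where \<open>\<mu>\<^sup>j = 0\<close>, so all sums are finite (lemma \<open>Dfps_wedge\<close>).
  Finally, \<open>\<Prod>\<^sub>s (1 - Y\<^sub>s t)\<^sup>-\<^sup>1\<close> is the generating function of the complete symmetric polynomials
  (lemma \<open>prod_list_geom_nth\<close>), and comparing coefficients gives the formula.
\<close>

unbundle fps_syntax

section \<open>Scalars in the exterior algebra and its power series\<close>

text \<open>Scalars sit on the empty word, which commutes with all words; hence they may be pulled out of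
  either factor of an exterior product.\<close>

lemma single_0_central:
  fixes x :: "'m::monoid_add \<Rightarrow>\<^sub>0 'a::comm_semiring_1"
  shows "x * Poly_Mapping.single 0 c = Poly_Mapping.single 0 c * x"
proof (induction x rule: update_induct)
  case const
  show ?case by simp
next
  case (update f w b)
  have "Poly_Mapping.update w b f = Poly_Mapping.single w b + f"
    using update(1) by (intro poly_mapping_eqI)
      (auto simp: lookup_update lookup_add lookup_single when_def in_keys_iff)
  then show ?case
    using update by (simp add: distrib_left distrib_right mult_single mult.commute)
qed

lemma scaleE_mult_right: "x * scaleE c y = scaleE c (x * y)"
  by (transfer, rule Ext_relI) (metis single_0_central mult.assoc)

lemma emb_0: "emb 0 = 0"
  using emb_add[of 0 0] by simp

interpretation scaleE: module scaleE
  by (rule module_scaleE)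

text \<open>The image of \<open>c \<otimes> x\<close> in the power series over the exterior algebra.  Series with coefficients in
  \<open>A\<close> act on that ring through multiplication by \<open>tens c 1\<close>.\<close>

definition tens :: "('n::finite) base fps \<Rightarrow> 'n Ext \<Rightarrow> 'n Ext fps" where
  "tens c x = Abs_fps (\<lambda>l. scaleE (c $ l) x)"

lemma tens_nth [simp]: "tens c x $ l = scaleE (c $ l) x"
  by (simp add: tens_def)

lemma tens_mult: "tens c x * tens d y = tens (c * d) (x * y)"
  by (rule fps_ext)
    (simp add: fps_mult_nth scaleE_mult_left scaleE_mult_right scaleE.scale_sum_left mult.commute)

definition geom :: "'a::comm_ring_1 \<Rightarrow> 'a fps" where
  "geom y = Abs_fps (\<lambda>u. y ^ u)"

text \<open>The assumptions are the coefficients of \<open>(1 - yt) M = x + t M'\<close>, where \<open>t\<close> is the variable of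
  the power series, and \<open>geom y\<close> is the inverse of \<open>1 - yt\<close>.\<close>

lemma tens_geom_solve:
  assumes "M $ 0 = x" and "\<And>l. M $ Suc l = M' $ l + scaleE y (M $ l)"
  shows "M = tens (geom y) x + tens (fps_X * geom y) 1 * M'"
proof (rule fps_ext)
  fix l
  define g where "g = fps_X * geom y"
  have g: "g $ 0 = 0" "g $ Suc i = y ^ i" for i
    by (simp_all add: g_def geom_def)
  have g_Suc: "(tens g 1 * M') $ Suc l = (\<Sum>i=0..l. scaleE (y ^ i) (M' $ (l - i)))" for l
    unfolding fps_mult_nth sum.atLeast0_atMost_Suc_shift by (simp add: g scaleE_mult_left)
  have step: "(tens g 1 * M') $ Suc l = M' $ l + scaleE y ((tens g 1 * M') $ l)" for l
  proof (cases l)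
    case 0
    then show ?thesis unfolding g_Suc by (simp add: g)
  next
    case (Suc k)
    then show ?thesis
      unfolding Suc g_Suc sum.atLeast0_atMost_Suc_shift[of _ k]
      by (simp add: scaleE.scale_sum_right)
  qed
  have "M $ l = (tens (geom y) x + tens g 1 * M') $ l"
  proof (induction l)
    case 0
    then show ?case by (simp add: assms(1) geom_def g)
  next
    case (Suc l)
    then show ?case
      by (simp only: assms(2) fps_add_nth step) (simp add: geom_def scaleE.scale_right_distrib)
  qed
  then show "M $ l = (tens (geom y) x + tens (fps_X * geom y) 1 * M') $ l"
    by (simp only: g_def)
qed

section \<open>The action on the module\<close>

text \<open>The isomorphism \<open>f \<mapsto> X f\<close> from \<open>A[X]\<close> to \<open>M\<close>, followed by the projection: it makes \<open>M(p)\<close> the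
  image of a total function, under which \<open>\<epsilon>\<^sup>i\<^sup>+\<^sup>1\<close> comes from \<open>X\<^sup>i\<close>, and \<open>\<mu>\<^sup>i\<close> from \<open>p\<^sub>i\<^sub>-\<^sub>1\<close>.\<close>

definition cls :: "('n::finite) base poly \<Rightarrow> 'n Mp" where
  "cls f = abs_Mp ([:0, 1:] * f)"

lemma cls_add: "cls (f + g) = cls f + cls g"
  by (simp only: cls_def distrib_left plus_Mp.abs_eq Mp_rel_refl XM_X)

lemma cls_smult: "cls (smult c f) = scaleMp c (cls f)"
  by (simp only: cls_def mult_smult_right scaleMp.abs_eq Mp_rel_refl XM_X)

lemma cls_0: "cls 0 = 0"
  using cls_add[of 0 0] by simp

lemma eps_Suc: "eps (Suc i) = cls ([:0, 1:] ^ i)"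
  by (simp only: eps_def cls_def map_fun_apply id_apply power_Suc nat.distinct if_False)

lemma cls_pp_top: "cls (f * pp CARD('n)) = (0 :: ('n::finite) Mp)"
proof -
  have "[:0, 1:] * (f * pp CARD('n)) = pfull * ([:0, 1:] * f)"
    by (simp only: pfull_def ac_simps)
  then have "Mp_rel ([:0, 1:] * (f * pp CARD('n))) (0 :: 'n base poly)"
    unfolding Mp_rel_def by (metis XM_X XM_0 imageI diff_zero)
  then show ?thesis
    by (simp only: cls_def zero_Mp_def Quotient3_rel_abs[OF Quotient3_Mp])
qed

lemma mu_eq_cls: "i \<in> {1..CARD('n)} \<Longrightarrow> (mu i :: ('n::finite) Mp) = cls (pp (i - 1))"
  by (simp only: mu_def cls_def map_fun_apply id_apply if_True)

lemma mu_eq_0: "i > CARD('n) \<Longrightarrow> (mu i :: ('n::finite) Mp) = 0"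
  by (simp add: mu_def zero_Mp_def)

text \<open>The condition \<open>D\<^sub>h \<epsilon>\<^sup>i = \<epsilon>\<^sup>i\<^sup>+\<^sup>h\<close> says this for powers of \<open>X\<close>; it extends to all polynomials by
  linearity.\<close>

lemma canonical_seq_cls:
  fixes D :: "nat \<Rightarrow> ('n::finite) Ext \<Rightarrow> 'n Ext"
  assumes D: "canonical_seq D"
  shows "D h (emb (cls f)) = emb (cls ([:0, 1:] ^ h * f))"
proof -
  interpret D: module_hom scaleE scaleE "D h"
    using D by (simp add: canonical_seq_def)
  \<comment> \<open>The extra power of \<open>X\<close> absorbs the shift when a polynomial is split into its constant term
    and the rest.\<close>
  have "D h (emb (cls ([:0, 1:] ^ k * f))) = emb (cls ([:0, 1:] ^ h * ([:0, 1:] ^ k * f)))" for k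
  proof (induction f arbitrary: k)
    case 0
    then show ?case by (simp add: cls_0 emb_0)
  next
    case (pCons a f)
    have split: "g * pCons a f = smult a g + g * [:0, 1:] * f" for g :: "'n base poly"
      by simp
    have step: "[:0, 1:] ^ h' * pCons a f = smult a ([:0, 1:] ^ h') + [:0, 1:] ^ Suc h' * f" for h'
      by (simp only: split power_Suc2)
    have "D h (emb (cls ([:0, 1:] ^ k))) = emb (cls ([:0, 1:] ^ (h + k)))"
      using D unfolding canonical_seq_def eps_Suc[symmetric]
      by (simp add: add.commute)
    moreover have "D h (emb (cls ([:0, 1:] ^ Suc k * f))) =
        emb (cls ([:0, 1:] ^ Suc (h + k) * f))"
      using pCons.IH[of "Suc k"]
      by (simp only: mult.assoc[symmetric] power_add[symmetric] add_Suc_right)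
    ultimately show ?case
      unfolding mult.assoc[symmetric] power_add[symmetric]
      unfolding step
      by (simp only: cls_add cls_smult emb_add emb_scale D.add D.scale)
  qed
  from this[of 0] show ?thesis by simp
qed

text \<open>The representatives of \<open>\<mu>\<^sup>i\<close> and \<open>\<mu>\<^sup>i\<^sup>+\<^sup>1\<close> differ by the factor \<open>X - Y\<^sub>i\<close>, so
  \<open>X \<mu>\<^sup>i = \<mu>\<^sup>i\<^sup>+\<^sup>1 + Y\<^sub>i \<mu>\<^sup>i\<close>; multiply by \<open>X\<^sup>l\<close>.  This holds at \<open>i = n\<close> because \<open>X p\<^sub>n\<close> vanishes in \<open>M(p)\<close>,
  and for \<open>i > n\<close> because both sides are zero, whatever \<open>Y\<^sub>i\<close> is.\<close>

lemma canonical_seq_mu: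
  fixes D :: "nat \<Rightarrow> ('n::finite) Ext \<Rightarrow> 'n Ext"
  assumes D: "canonical_seq D" and i: "1 \<le> i"
  shows "D 0 (emb (mu i)) = emb (mu i)"
    and "D (Suc l) (emb (mu i)) = D l (emb (mu (Suc i))) + scaleE (Y i) (D l (emb (mu i)))"
proof -
  have D0: "D h 0 = 0" for h
    using D module_hom.zero unfolding canonical_seq_def by blast
  show "D 0 (emb (mu i)) = emb (mu i)"
    using i by (cases "i \<le> CARD('n)")
      (simp_all add: mu_eq_cls mu_eq_0 emb_0 D0 canonical_seq_cls[OF D])
  show "D (Suc l) (emb (mu i)) = D l (emb (mu (Suc i))) + scaleE (Y i) (D l (emb (mu i)))"
  proof (cases "i \<le> CARD('n)")
    case True
    have "{1..i} = insert i {1..i - 1}" using i by auto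
    then have "(pp i :: 'n base poly) = [:- Y i, 1:] * pp (i - 1)"
      using i by (simp add: pp_def)
    then have "[:0, 1:] * (pp (i - 1) :: 'n base poly) = pp i + smult (Y i) (pp (i - 1))"
      by simp
    then have "[:0, 1:] ^ Suc l * (pp (i - 1) :: 'n base poly) =
        [:0, 1:] ^ l * pp i + smult (Y i) ([:0, 1:] ^ l * pp (i - 1))"
      by (simp only: power_Suc2 mult.assoc distrib_left mult_smult_right)
    moreover have "D l (emb (mu (Suc i))) = emb (cls ([:0, 1:] ^ l * pp i))"
    proof (cases "i = CARD('n)")
      case True
      have "cls ([:0, 1:] ^ l * pp CARD('n)) = (0 :: 'n Mp)"
        by (rule cls_pp_top)
      then show ?thesis using True by (simp add: mu_eq_0 emb_0 D0)
    qed (use True in \<open>simp add: mu_eq_cls canonical_seq_cls[OF D]\<close>)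
    ultimately show ?thesis
      using True i
      by (simp only: mu_eq_cls atLeastAtMost_iff canonical_seq_cls[OF D] simp_thms cls_add cls_smult
          emb_add emb_scale)
  qed (simp add: mu_eq_0 emb_0 D0)
qed

section \<open>Complete symmetric polynomials\<close>

lemma chsym_Nil: "chsym u [] = (if u = 0 then 1 else 0)"
proof -
  have "{e. length e = length ([] :: 'a list) \<and> sum_list e = u} = (if u = 0 then {[]} else {})"
    by auto
  then show ?thesis by (simp add: chsym_def)
qed

lemma finite_exponents: "finite {e :: nat list. length e = n \<and> sum_list e = u}"
proof (rule finite_subset)
  show "{e. length e = n \<and> sum_list e = u} \<subseteq> {e. set e \<subseteq> {..u} \<and> length e = n}"
    using member_le_sum_list by fastforce
qed (simp add: finite_lists_length_eq)

lemma chsym_Cons: "chsym u (y # ys) = (\<Sum>a=0..u. y ^ a * chsym (u - a) ys)"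
proof -
  let ?E = "\<lambda>u. {e. length e = length ys \<and> sum_list e = u}"
  have "{e. length e = length (y # ys) \<and> sum_list e = u} =
      (\<lambda>(a, e). a # e) ` (SIGMA a:{0..u}. ?E (u - a))"
    by (fastforce simp: length_Suc_conv image_iff)
  moreover have "inj_on (\<lambda>(a, e). a # e) (SIGMA a:{0..u}. ?E (u - a))"
    by (auto simp: inj_on_def)
  ultimately show ?thesis
    by (simp add: chsym_def sum.reindex sum.Sigma finite_exponents prod.lessThan_Suc_shift
        sum_distrib_left split_def del: prod.lessThan_Suc)
qed

text \<open>The factor \<open>geom y = (1 - yt)\<^sup>-\<^sup>1\<close> contributes the power of \<open>y\<close> in each monomial, so the product is
  the generating function of the complete symmetric polynomials.\<close>

lemma prod_list_geom_nth: "prod_list (map geom ys) $ u = chsym u ys"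
  by (induction ys arbitrary: u) (simp_all add: chsym_Nil chsym_Cons fps_mult_nth geom_def)

section \<open>Expanding the exterior products\<close>

definition Dfps :: "(nat \<Rightarrow> ('n::finite) Ext \<Rightarrow> 'n Ext) \<Rightarrow> 'n Ext \<Rightarrow> 'n Ext fps" where
  "Dfps D x = Abs_fps (\<lambda>l. D l x)"

lemma Dfps_mult:
  assumes "canonical_seq D"
  shows "Dfps D (x * y) = Dfps D x * Dfps D y"
proof (rule fps_ext)
  fix l
  have "(\<Sum>(h1, h2)\<in>{(h1, h2). h1 + h2 = l}. D h1 x * D h2 y) = (\<Sum>i=0..l. D i x * D (l - i) y)"
    by (rule sum.reindex_bij_witness[of _ "\<lambda>i. (i, l - i)" fst]) auto
  then show "Dfps D (x * y) $ l = (Dfps D x * Dfps D y) $ l"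
    using assms by (simp add: Dfps_def fps_mult_nth canonical_seq_def)
qed

lemma Dfps_0:
  assumes "canonical_seq D"
  shows "Dfps D 0 = 0"
proof -
  have "D l 0 = 0" for l
    using assms module_hom.zero unfolding canonical_seq_def by blast
  then show ?thesis by (simp add: Dfps_def fps_eq_iff)
qed

text \<open>The coefficient \<open>t\<^sup>d \<Prod>\<^sub>s (1 - Y\<^sub>s t)\<^sup>-\<^sup>1\<close> of \<open>\<mu>\<^sup>i\<^sup>+\<^sup>d\<close> in \<open>D(\<mu>\<^sup>i)\<close>, where \<open>s\<close> runs from \<open>i\<close> to
  \<open>i + d\<close>.\<close>

definition mu_coeff :: "nat \<Rightarrow> nat \<Rightarrow> ('n::finite) base fps" where
  "mu_coeff i d = fps_X ^ d * prod_list (map (geom \<circ> Y) [i..<Suc (i + d)])"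

text \<open>Each step expands \<open>D(\<mu>\<^sup>i\<^sup>+\<^sup>d)\<close> in the remainder by the recursion
  \<open>(1 - Y\<^sub>s t) D(\<mu>\<^sup>s) = \<mu>\<^sup>s + t D(\<mu>\<^sup>s\<^sup>+\<^sup>1)\<close>.  The decomposition is kept for every \<open>d\<close>, since the
  remainder has to be compared with the neighbouring factor of an exterior product.\<close>

lemma Dfps_mu_split:
  fixes D :: "nat \<Rightarrow> ('n::finite) Ext \<Rightarrow> 'n Ext"
  assumes D: "canonical_seq D" and i: "1 \<le> i"
  shows "Dfps D (emb (mu i)) = (\<Sum>m<d. tens (mu_coeff i m) (emb (mu (i + m)))) +
    tens (fps_X ^ d * prod_list (map (geom \<circ> Y) [i..<i + d])) 1 * Dfps D (emb (mu (i + d)))"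
proof (induction d)
  case 0
  have "tens 1 1 * x = x" for x :: "'n Ext fps"
    by (rule fps_ext) (simp add: fps_mult_nth if_distrib scaleE_mult_left sum.atLeast_Suc_atMost)
  then show ?case by simp
next
  case (Suc d)
  let ?P = "\<lambda>d. prod_list (map (geom \<circ> Y) [i..<i + d]) :: 'n base fps"
  have "Dfps D (emb (mu (i + d))) = tens (geom (Y (i + d))) (emb (mu (i + d))) +
      tens (fps_X * geom (Y (i + d))) 1 * Dfps D (emb (mu (i + Suc d)))"
    using canonical_seq_mu[OF D, of "i + d"] i by (intro tens_geom_solve) (simp_all add: Dfps_def)
  moreover have "mu_coeff i d = fps_X ^ d * ?P d * geom (Y (i + d))"
    and "fps_X ^ Suc d * ?P (Suc d) = fps_X ^ d * ?P d * (fps_X * geom (Y (i + d)))"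
    by (simp_all add: mu_coeff_def ac_simps)
  ultimately show ?case
    using Suc.IH
    by (simp only: distrib_left mult.assoc[symmetric] tens_mult mult_1_left add.assoc
        sum.lessThan_Suc)
qed

text \<open>With \<open>n + 1\<close> as an index after the last one, the last entry of a tuple of shifts is bounded in
  the same way as the others.  This replaces the infinite union of the sets \<open>\<P>(I, h)\<close> over all \<open>h\<close>
  by a finite product of intervals; the tuples left out are those that move the last index
  beyond \<open>n\<close>, and so contribute zero.\<close>

definition next_index :: "nat \<Rightarrow> nat list \<Rightarrow> nat" where
  "next_index n I = (case I of [] \<Rightarrow> Suc n | j # _ \<Rightarrow> j)"

fun pieri_box :: "nat \<Rightarrow> nat list \<Rightarrow> nat list set" where
  "pieri_box n [] = {[]}"
| "pieri_box n (i # I) = (\<lambda>(d, m). d # m) ` ({..<next_index n I - i} \<times> pieri_box n I)"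

lemma finite_pieri_box: "finite (pieri_box n I)"
  by (induction I) simp_all

definition tuple_coeff :: "nat list \<Rightarrow> nat list \<Rightarrow> ('n::finite) base fps" where
  "tuple_coeff I m = fps_X ^ sum_list m * prod_list (map geom (Yargs I m))"

lemma tuple_coeff_Nil: "tuple_coeff [] m = fps_X ^ sum_list m"
  by (simp add: tuple_coeff_def Yargs_def)

lemma tuple_coeff_Cons: "tuple_coeff (i # I) (d # m) = mu_coeff i d * tuple_coeff I m"
  by (simp add: tuple_coeff_def mu_coeff_def Yargs_def power_add ac_simps)

lemma pieri_box_sum_Cons:
  "(\<Sum>m\<in>pieri_box n (i # I). f m) = (\<Sum>d<next_index n I - i. \<Sum>m\<in>pieri_box n I. f (d # m))"
  by (subst pieri_box.simps, subst sum.reindex)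
    (auto simp: inj_on_def sum.cartesian_product split_def)

text \<open>The remainder of the first factor after truncation at the next index \<open>j\<close> is a multiple of
  \<open>D(\<mu>\<^sup>j)\<close>, which annihilates \<open>D(\<mu>\<^sup>j \<and> \<dots>)\<close>.  The induction starts from a single index, as the
  Leibniz rule by itself only says that \<open>D(1)\<close> is idempotent.\<close>

lemma Dfps_wedge:
  fixes D :: "nat \<Rightarrow> ('n::finite) Ext \<Rightarrow> 'n Ext"
  assumes D: "canonical_seq D"
  shows "I \<noteq> [] \<Longrightarrow> sorted_wrt (<) I \<Longrightarrow> set I \<subseteq> {1..CARD('n)} \<Longrightarrow>
    Dfps D (wedge (map mu I)) =
      (\<Sum>m\<in>pieri_box CARD('n) I. tens (tuple_coeff I m) (wedge (map mu (map2 (+) I m))))"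
proof (induction I rule: list_nonempty_induct)
  case (single i)
  then have "i + (Suc CARD('n) - i) = Suc CARD('n)" by auto
  then have "Dfps D (emb (mu i)) =
      (\<Sum>d<Suc CARD('n) - i. tens (mu_coeff i d) (emb (mu (i + d))))"
    using Dfps_mu_split[OF D, of i "Suc CARD('n) - i"] single
    by (simp add: mu_eq_0 emb_0 Dfps_0[OF D])
  then show ?case
    by (simp only: pieri_box_sum_Cons) (simp add: next_index_def tuple_coeff_Cons tuple_coeff_Nil wedge_def)
next
  case (cons i I)
  then obtain j J where I: "I = j # J" by (cases I) auto
  let ?w = "wedge (map mu I) :: 'n Ext"
  have "emb (mu j) * ?w = emb (mu j) * emb (mu j) * wedge (map mu J)"
    by (simp add: I wedge_def mult.assoc)
  then have kill: "Dfps D (emb (mu j)) * Dfps D ?w = 0"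
    by (simp only: Dfps_mult[OF D, symmetric] emb_square mult_zero_left Dfps_0[OF D])
  have "Dfps D (emb (mu i)) = (\<Sum>d<j - i. tens (mu_coeff i d) (emb (mu (i + d)))) +
      tens (fps_X ^ (j - i) * prod_list (map (geom \<circ> Y) [i..<j])) 1 * Dfps D (emb (mu j))"
    using Dfps_mu_split[OF D, of i "j - i"] cons.prems I by simp
  then have "Dfps D (emb (mu i)) * Dfps D ?w =
      (\<Sum>d<j - i. tens (mu_coeff i d) (emb (mu (i + d)))) * Dfps D ?w"
    by (simp add: distrib_right mult.assoc kill)
  moreover have "wedge (map mu (i # I)) = emb (mu i) * ?w"
    by (simp add: wedge_def)
  moreover have "Dfps D ?w = (\<Sum>m\<in>pieri_box CARD('n) I.
      tens (tuple_coeff I m) (wedge (map mu (map2 (+) I m))))"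
    using cons by simp
  ultimately have "Dfps D (wedge (map mu (i # I))) = (\<Sum>d<j - i. \<Sum>m\<in>pieri_box CARD('n) I.
      tens (mu_coeff i d) (emb (mu (i + d))) *
      tens (tuple_coeff I m) (wedge (map mu (map2 (+) I m))))"
    by (simp only: Dfps_mult[OF D] sum_product)
  also have "\<dots> = (\<Sum>d<j - i. \<Sum>m\<in>pieri_box CARD('n) I.
      tens (tuple_coeff (i # I) (d # m)) (wedge (map mu (map2 (+) (i # I) (d # m)))))"
    by (simp add: tens_mult tuple_coeff_Cons wedge_def)
  finally show ?case
    by (simp only: pieri_box_sum_Cons) (simp add: I next_index_def)
qed

section \<open>Pieri's formula\<close>

lemma pieri_set_Cons_iff:
  "d # m \<in> pieri_set (i # I) h \<longleftrightarrow>
    d \<le> h \<and> (I \<noteq> [] \<longrightarrow> i + d < hd I) \<and> m \<in> pieri_set I (h - d)"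
  by (cases I) (auto simp: pieri_set_def nth_Cons less_Suc_eq_0_disj all_conj_distrib split: nat.splits)

lemma finite_pieri_set: "finite (pieri_set I h)"
  by (rule finite_subset[OF _ finite_exponents[of "length I" h]]) (auto simp: pieri_set_def)

lemma pieri_box_iff:
  assumes "I \<noteq> []" and "set I \<subseteq> {1..n}" and "sorted_wrt (<) I"
  shows "m \<in> pieri_box n I \<longleftrightarrow> m \<in> pieri_set I (sum_list m) \<and> last (map2 (+) I m) \<le> n"
  using assms
proof (induction I arbitrary: m rule: list_nonempty_induct)
  case (single i)
  then show ?case
    by (auto simp: pieri_set_def next_index_def length_Suc_conv image_iff)
next
  case (cons i I)
  then obtain j J where I: "I = j # J" by (cases I) auto
  show ?case
  proof (cases m)
    case (Cons d m')
    have "m' \<in> pieri_set I h \<Longrightarrow> map2 (+) I m' \<noteq> []" for h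
      using I by (auto simp: pieri_set_def length_Suc_conv)
    then show ?thesis
      using cons Cons
      by (auto simp: pieri_set_Cons_iff I next_index_def)
  qed (auto simp: pieri_set_def)
qed

lemma wedge_mu_eq_0:
  assumes "s \<in> set J" and "s > CARD('n)"
  shows "wedge (map mu J) = (0 :: ('n::finite) Ext)"
  using assms by (induction J) (auto simp: wedge_def mu_eq_0 emb_0)

theorem theorem4p5:
  fixes D :: "nat \<Rightarrow> ('n::finite) Ext \<Rightarrow> 'n Ext"
    and I :: "nat list" and k l :: nat
  assumes "canonical_seq D"
    and "1 \<le> k" and "k \<le> CARD('n)"
    and "length I = k" and "sorted_wrt (<) I" and "set I \<subseteq> {1..CARD('n)}"
  shows "D l (wedge (map mu I)) =
    (\<Sum>u=0..l. \<Sum>m \<in> pieri_set I (l - u).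
       scaleE (chsym u (Yargs I m)) (wedge (map mu (map2 (+) I m))))"
proof -
  let ?w = "\<lambda>m. wedge (map mu (map2 (+) I m)) :: 'n Ext"
  let ?B = "pieri_box CARD('n) I"
  have I: "I \<noteq> []" using assms by auto
  note box_iff = pieri_box_iff[OF I assms(6,5)]
  \<comment> \<open>The tuples of \<open>\<P>(I, l - u)\<close> outside the box move the last index beyond \<open>n\<close> and contribute zero.\<close>
  have inner: "(\<Sum>m\<in>pieri_set I (l - u). scaleE (chsym u (Yargs I m)) (?w m)) =
      (\<Sum>m\<in>{m \<in> ?B. sum_list m + u = l}. scaleE (chsym (l - sum_list m) (Yargs I m)) (?w m))"
    if u: "u \<in> {0..l}" for u
  proof (rule sum.mono_neutral_cong_right[OF finite_pieri_set])
    have sum: "sum_list m = h" if "m \<in> pieri_set I h" for m h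
      using that by (simp add: pieri_set_def)
    show "{m \<in> ?B. sum_list m + u = l} \<subseteq> pieri_set I (l - u)"
      by (auto simp: box_iff)
    show "\<forall>m\<in>pieri_set I (l - u) - {m \<in> ?B. sum_list m + u = l}.
        scaleE (chsym u (Yargs I m)) (?w m) = 0"
    proof
      fix m assume "m \<in> pieri_set I (l - u) - {m \<in> ?B. sum_list m + u = l}"
      then have m: "m \<in> pieri_set I (l - u)" and "last (map2 (+) I m) > CARD('n)"
        using u sum[of m "l - u"] by (auto simp: box_iff)
      moreover have "map2 (+) I m \<noteq> []"
        using m I by (auto simp: pieri_set_def zip_eq_Nil_iff)
      ultimately have "?w m = 0"
        by (intro wedge_mu_eq_0[OF last_in_set])
      then show "scaleE (chsym u (Yargs I m)) (?w m) = 0"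
        by simp
    qed
  qed (use u in auto)
  have "D l (wedge (map mu I)) = Dfps D (wedge (map mu I)) $ l"
    by (simp add: Dfps_def)
  also have "\<dots> = (\<Sum>m\<in>?B. scaleE (tuple_coeff I m $ l) (?w m))"
    by (simp add: Dfps_wedge[OF assms(1) I assms(5,6)] fps_sum_nth)
  also have "\<dots> = (\<Sum>m\<in>{m \<in> ?B. sum_list m \<le> l}.
      scaleE (chsym (l - sum_list m) (Yargs I m)) (?w m))"
    by (rule sum.mono_neutral_cong_right)
      (auto simp: finite_pieri_box tuple_coeff_def fps_X_power_mult_nth prod_list_geom_nth)
  also have "\<dots> = (\<Sum>u=0..l. \<Sum>m\<in>{m \<in> {m \<in> ?B. sum_list m \<le> l}. l - sum_list m = u}.
      scaleE (chsym (l - sum_list m) (Yargs I m)) (?w m))"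
    by (rule sum.group[symmetric]) (auto simp: finite_pieri_box)
  also have "\<dots> = (\<Sum>u=0..l. \<Sum>m\<in>{m \<in> ?B. sum_list m + u = l}.
      scaleE (chsym (l - sum_list m) (Yargs I m)) (?w m))"
    by (intro sum.cong) auto
  also have "\<dots> = (\<Sum>u=0..l. \<Sum>m \<in> pieri_set I (l - u).
      scaleE (chsym u (Yargs I m)) (?w m))"
    by (intro sum.cong[OF refl] inner[symmetric])
  finally show ?thesis .
qed

end
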